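(* The function $h(x)=\sum_{p\text{ prime}}\frac{1}{xp^2-p+1}$ is well-defined, real-analytic, and positive on $\bigl(\tfrac14,+\infty\bigr)$.
   Context: The sum ranges over all prime numbers $p=2,3,5,7,\ldots$. *)

theory Defs
  imports "HOL-Analysis.Analysis" "HOL-Computational_Algebra.Primes"
begin

text \<open>
  Real-analyticity: near each point of \<open>S\<close> the function is the sum of a power series with positive
  radius of convergence. The neighbourhood is taken in the real line, so for a non-open \<open>S\<close> this
  means analyticity on some open superset, as for \<open>analytic_on\<close> over the complex numbers.
\<close>
definition real_analytic_on :: "(real \<Rightarrow> real) \<Rightarrow> real set \<Rightarrow> bool"
    (infixl \<open>(real'_analytic'_on)\<close> 50) where
  "f real_analytic_on S \<longleftrightarrow> (\<forall>a\<in>S. \<exists>F. (\<lambda>t. f (a + t)) has_fps_expansion F)"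

definition h_denom :: "real \<Rightarrow> nat \<Rightarrow> real" where
  "h_denom x p = x * (real p)\<^sup>2 - real p + 1"

text \<open>
  Both division and \<open>infsum\<close> are total (\<open>1 / 0 = 0\<close>, and the sum is \<open>0\<close> without summability),
  so well-definedness of \<open>h\<close> at \<open>x\<close> is stated separately.
\<close>
definition h_defined_at :: "real \<Rightarrow> bool" where
  "h_defined_at x \<longleftrightarrow>
     (\<forall>p. prime p \<longrightarrow> h_denom x p \<noteq> 0) \<and>
     (\<lambda>p. 1 / h_denom x p) summable_on {p. prime p}"

definition h :: "real \<Rightarrow> real" where
  "h x = (\<Sum>\<^sub>\<infinity>p\<in>{p. prime p}. 1 / h_denom x p)"

end

theory Submission
  imports Defs
begin

text \<open>
  Write \<open>x p\<^sup>2 - p + 1 = (x - 1/4) p\<^sup>2 + (p/2 - 1)\<^sup>2\<close>. For \<open>x > 1/4\<close> every denominator is thus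
  at least \<open>(x - 1/4) p\<^sup>2\<close>, so the terms are positive and dominated by a multiple of
  \<open>1 / p\<^sup>2\<close>. This gives well-definedness and positivity.

  For analyticity at \<open>a > 1/4\<close>, put \<open>D\<^sub>p = a p\<^sup>2 - p + 1\<close>. The term at \<open>a + t\<close> is
  \<open>(1 / D\<^sub>p) / (1 + (p\<^sup>2 / D\<^sub>p) t)\<close>, where \<open>p\<^sup>2 / D\<^sub>p \<le> 1 / (a - 1/4)\<close> uniformly in \<open>p\<close>. The
  geometric series of all terms therefore converge on a common disc, and the absolutely convergent
  double series can be summed in the other order: this is the general lemma
  \<open>has_fps_expansion_infsum_geometric\<close>.
\<close>

text \<open>
  On \<open>\<bar>t\<bar> < 1 / K\<close> each summand is a geometric series in \<open>- q i * t\<close>, dominated in \<open>n\<close> by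
  \<open>\<bar>u i\<bar> (K \<bar>t\<bar>)\<^sup>n\<close>. The double family is thus dominated by a product of two summable families,
  and interchanging the sums exhibits the power series.
\<close>
lemma has_fps_expansion_infsum_geometric:
  fixes u q :: "'i \<Rightarrow> real"
  assumes u: "(\<lambda>i. \<bar>u i\<bar>) summable_on I"
    and q: "\<And>i. i \<in> I \<Longrightarrow> \<bar>q i\<bar> \<le> K"
    and K: "K > 0"
  shows "(\<lambda>t. \<Sum>\<^sub>\<infinity>i\<in>I. u i / (1 + q i * t)) has_fps_expansion
           Abs_fps (\<lambda>n. \<Sum>\<^sub>\<infinity>i\<in>I. u i * (- q i) ^ n)"
proof -
  define c where "c n = (\<Sum>\<^sub>\<infinity>i\<in>I. u i * (- q i) ^ n)" for n
  have sums: "(\<lambda>n. c n * t ^ n) sums (\<Sum>\<^sub>\<infinity>i\<in>I. u i / (1 + q i * t))"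
    if t: "\<bar>t\<bar> < 1 / K" for t
  proof -
    have Kt: "K * \<bar>t\<bar> < 1"
      using t K by (simp add: field_simps)
    define f where "f i n = u i * (- q i * t) ^ n" for i n
    have bound: "\<bar>q i * t\<bar> \<le> K * \<bar>t\<bar>" if "i \<in> I" for i
      using q[OF that] by (simp add: abs_mult mult_right_mono)
    have geom: "(\<lambda>n. (K * \<bar>t\<bar>) ^ n) summable_on UNIV"
      using Kt K by (intro summable_nonneg_imp_summable_on) (simp_all add: summable_geometric)
    have dom: "(\<lambda>x. norm (case x of (i, n) \<Rightarrow> u i * (K * \<bar>t\<bar>) ^ n)) summable_on I \<times> UNIV"
      unfolding Infinite_Sum.abs_summable_on_Sigma_iff
    proof (intro conjI ballI)
      show "(\<lambda>n. norm (case (i, n) of (i, n) \<Rightarrow> u i * (K * \<bar>t\<bar>) ^ n)) summable_on UNIV" for i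
        using summable_on_cmult_right[OF geom, of "\<bar>u i\<bar>"] K by (simp add: abs_mult power_abs)
      have "(\<lambda>i. \<bar>u i\<bar> * (\<Sum>\<^sub>\<infinity>n. (K * \<bar>t\<bar>) ^ n)) summable_on I"
        using summable_on_cmult_left[OF u] by simp
      then show "(\<lambda>i. norm (\<Sum>\<^sub>\<infinity>n. norm (case (i, n) of (i, n) \<Rightarrow> u i * (K * \<bar>t\<bar>) ^ n)))
              summable_on I"
        using K by (simp add: abs_mult power_abs infsum_cmult_right' infsum_nonneg)
    qed
    have "(\<lambda>x. norm (case x of (i, n) \<Rightarrow> f i n)) summable_on I \<times> UNIV"
    proof (rule Infinite_Sum.abs_summable_on_comparison_test[OF dom])
      fix x assume "x \<in> I \<times> (UNIV :: nat set)"
      then obtain i n where "x = (i, n)" "i \<in> I" by auto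
      then show "norm (case x of (i, n) \<Rightarrow> f i n)
                   \<le> norm (case x of (i, n) \<Rightarrow> u i * (K * \<bar>t\<bar>) ^ n)"
        using power_mono[OF bound[of i], of n] K
        by (simp add: f_def abs_mult power_abs mult_left_mono)
    qed
    then have summ: "(\<lambda>(i, n). f i n) summable_on I \<times> UNIV"
      by (rule abs_summable_summable)
    have inner: "(\<Sum>\<^sub>\<infinity>n. f i n) = u i / (1 + q i * t)" if "i \<in> I" for i
    proof -
      have "\<bar>- q i * t\<bar> < 1"
        using bound[OF that] Kt by simp
      then have "((\<lambda>n. (- q i * t) ^ n) has_sum (1 / (1 + q i * t))) UNIV"
        using geometric_sums[of "- q i * t"]
        by (intro norm_summable_imp_has_sum) (simp_all add: power_abs summable_geometric)
      then have "((\<lambda>n. f i n) has_sum (u i * (1 / (1 + q i * t)))) UNIV"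
        unfolding f_def by (rule has_sum_cmult_right)
      then show ?thesis
        using infsumI by fastforce
    qed
    have outer: "(\<Sum>\<^sub>\<infinity>i\<in>I. f i n) = c n * t ^ n" for n
      unfolding c_def f_def infsum_cmult_left'[symmetric]
      by (simp only: power_mult_distrib mult.assoc)
    have "(\<lambda>n. \<Sum>\<^sub>\<infinity>i\<in>I. f i n) summable_on UNIV"
    proof -
      have "(\<lambda>(n, i). f i n) summable_on UNIV \<times> I"
        using summ by (subst (asm) product_swap[symmetric])
          (simp add: summable_on_reindex o_def case_prod_unfold)
      then show ?thesis
        by (rule summable_on_Sigma_banach)
    qed
    then have "(\<lambda>n. \<Sum>\<^sub>\<infinity>i\<in>I. f i n) sums (\<Sum>\<^sub>\<infinity>n. \<Sum>\<^sub>\<infinity>i\<in>I. f i n)"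
      by (intro has_sum_imp_sums has_sum_infsum)
    also have "(\<Sum>\<^sub>\<infinity>n. \<Sum>\<^sub>\<infinity>i\<in>I. f i n) = (\<Sum>\<^sub>\<infinity>i\<in>I. \<Sum>\<^sub>\<infinity>n. f i n)"
      using infsum_swap_banach[OF summ] by simp
    also have "\<dots> = (\<Sum>\<^sub>\<infinity>i\<in>I. u i / (1 + q i * t))"
      by (intro infsum_cong inner)
    finally show ?thesis
      by (simp add: outer)
  qed
  show ?thesis
  proof (rule has_fps_expansionI)
    have "\<forall>\<^sub>F t in nhds 0. t \<in> ball 0 (1 / K)"
      using K by (intro eventually_nhds_in_open) auto
    then show "\<forall>\<^sub>F t in nhds 0.
        (\<lambda>n. fps_nth (Abs_fps (\<lambda>n. \<Sum>\<^sub>\<infinity>i\<in>I. u i * (- q i) ^ n)) n * t ^ n)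
          sums (\<Sum>\<^sub>\<infinity>i\<in>I. u i / (1 + q i * t))"
      by eventually_elim (use sums in \<open>auto simp: c_def\<close>)
  qed
qed

lemma h_denom_ge: "(x - 1/4) * (real p)\<^sup>2 \<le> h_denom x p"
proof -
  have "h_denom x p = (x - 1/4) * (real p)\<^sup>2 + (real p / 2 - 1)\<^sup>2"
    by (simp add: h_denom_def power2_eq_square field_simps)
  then show ?thesis by simp
qed

lemma h_denom_pos:
  assumes "x > 1/4" and "prime p"
  shows "h_denom x p > 0"
proof -
  have "(x - 1/4) * (real p)\<^sup>2 > 0"
    using assms prime_gt_0_nat[of p] by simp
  with h_denom_ge[of x p] show ?thesis by linarith
qed

lemma summable_on_inverse_h_denom:
  assumes x: "x > 1/4"
  shows "(\<lambda>p. 1 / h_denom x p) summable_on {p. prime p}"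
proof (rule summable_on_comparison_test)
  have "(\<lambda>n. inverse (real n ^ 2)) summable_on UNIV"
    by (intro summable_nonneg_imp_summable_on inverse_power_summable) auto
  then have "(\<lambda>n. 1 / (x - 1/4) * inverse (real n ^ 2)) summable_on UNIV"
    by (rule summable_on_cmult_right)
  then show "(\<lambda>n. 1 / (x - 1/4) * inverse (real n ^ 2)) summable_on {p. prime p}"
    by (rule summable_on_subset_banach) simp
next
  fix p :: nat assume p: "p \<in> {p. prime p}"
  have "1 / h_denom x p \<le> 1 / ((x - 1/4) * (real p)\<^sup>2)"
    using p x prime_gt_0_nat[of p] h_denom_pos[of x p] h_denom_ge[of x p]
    by (intro divide_left_mono) auto
  then show "1 / h_denom x p \<le> 1 / (x - 1/4) * inverse (real p ^ 2)"
    by (simp add: field_simps)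
  show "0 \<le> 1 / h_denom x p"
    using p x h_denom_pos[of x p] by simp
qed

lemma h_defined_at: "x > 1/4 \<Longrightarrow> h_defined_at x"
  unfolding h_defined_at_def
  using h_denom_pos summable_on_inverse_h_denom by (metis less_irrefl)

lemma h_pos:
  assumes x: "x > 1/4"
  shows "h x > 0"
proof -
  have "0 < 1 / h_denom x 2"
    using h_denom_pos[OF x two_is_prime_nat] by simp
  also have "\<dots> = (\<Sum>p\<in>{2}. 1 / h_denom x p)"
    by simp
  also have "\<dots> \<le> h x"
    unfolding h_def
    by (rule finite_sum_le_infsum[OF summable_on_inverse_h_denom[OF x]])
       (auto intro: less_imp_le h_denom_pos[OF x])
  finally show ?thesis .
qed

lemma h_real_analytic_on: "h real_analytic_on {1/4<..}"
  unfolding real_analytic_on_def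
proof
  fix a :: real assume "a \<in> {1/4<..}"
  then have a: "a > 1/4" by simp
  define u where "u p = 1 / h_denom a p" for p
  define q where "q p = (real p)\<^sup>2 / h_denom a p" for p
  have "(\<lambda>p. \<bar>u p\<bar>) summable_on {p. prime p}"
    using summable_on_inverse_h_denom[OF a, THEN summable_on_iff_abs_summable_on_real[THEN iffD1]]
    by (simp add: u_def)
  moreover have "\<bar>q p\<bar> \<le> 1 / (a - 1/4)" if "p \<in> {p. prime p}" for p
    using that a h_denom_pos[OF a, of p] h_denom_ge[of a p]
    unfolding q_def by (simp add: divide_simps mult.commute)
  ultimately have "(\<lambda>t. \<Sum>\<^sub>\<infinity>p\<in>{p. prime p}. u p / (1 + q p * t)) has_fps_expansion
      Abs_fps (\<lambda>n. \<Sum>\<^sub>\<infinity>p\<in>{p. prime p}. u p * (- q p) ^ n)"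
    using a by (intro has_fps_expansion_infsum_geometric[where K = "1 / (a - 1/4)"]) auto
  \<comment> \<open>The denominator is affine in \<open>x\<close>, so factoring out its value at \<open>a\<close> leaves \<open>1 + q p * t\<close>.\<close>
  moreover have "u p / (1 + q p * t) = 1 / h_denom (a + t) p" if "prime p" for p t
  proof -
    have "h_denom (a + t) p = h_denom a p * (1 + q p * t)"
      using h_denom_pos[OF a that]
      by (simp add: q_def distrib_left) (simp add: h_denom_def algebra_simps)
    then show ?thesis
      by (simp add: u_def)
  qed
  then have "(\<lambda>t. \<Sum>\<^sub>\<infinity>p\<in>{p. prime p}. u p / (1 + q p * t)) = (\<lambda>t. h (a + t))"
    unfolding h_def by (intro ext infsum_cong) simp
  ultimately show "\<exists>F. (\<lambda>t. h (a + t)) has_fps_expansion F"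
    by auto
qed

theorem proposition2p2:
  shows "(\<forall>x\<in>{1/4<..}. h_defined_at x) \<and>
         h real_analytic_on {1/4<..} \<and>
         (\<forall>x\<in>{1/4<..}. h x > 0)"
  using h_defined_at h_real_analytic_on h_pos by simp

end
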